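(* Let $p\ge2$ and consider the hypergeometric weights, the Gauss--Borel factorization $\mathscr M=S^{-1}H\tilde S^{-\top}$ and the recurrence matrix $T$ described in the context. Fix $a\ne m$ in $\{1,\dots,p\}$, $r\in\{1,\dots,M^{(a)}\}$, $q\in\{1,\dots,M^{(m)}\}$, $s\in\{1,\dots,N\}$. Let $\hat\Theta$, $\check\Theta$, $\Theta_s$ denote the parameter shifts $b_r^{(a)}\to b_r^{(a)}+1$, $b_q^{(m)}\to b_q^{(m)}+1$, $c_s\to c_s-1$, respectively, and define $$\omega^{(r)}=(\hat\Theta H)^{-1}(\hat\Theta\tilde S)(\Lambda^{(a)}+b_r^{(a)}I)\tilde S^{-1}H,\quad \omega^{(q)}=(\check\Theta H)^{-1}(\check\Theta\tilde S)(\Lambda^{(m)}+b_q^{(m)}I)\tilde S^{-1}H,$$ $$\omega^{(s)}=(\Theta_s H)^{-1}(\Theta_s\tilde S)(\Lambda^{p}+(c_s-1)I)\tilde S^{-1}H.$$ Then $$(\hat\Theta T)^\top\omega^{(r)}=\omega^{(r)}T^\top,\qquad(\check\Theta T)^\top\omega^{(q)}=\omega^{(q)}T^\top,\qquad(\Theta_sT)^\top\omega^{(s)}=\omega^{(s)}T^\top.$$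
   Context: All semi-infinite matrices are indexed from $0$. $\Lambda$ is the shift matrix with $\Lambda_{n,n+1}=1$ and all other entries zero; $I^{(a)}$ is the diagonal matrix with entry $1$ at positions $n\equiv a-1\pmod p$ and $0$ elsewhere; $\Lambda^{(a)}=\Lambda^pI^{(a)}$. Weights: $w^{(a)}(k)=\frac{(b_1^{(a)})_k\cdots(b_{M^{(a)}}^{(a)})_k}{(c_1)_k\cdots(c_N)_k}\frac{(\eta^{(a)})^k}{k!}$, $k\in\mathbb N_0$, $a\in\{1,\dots,p\}$; the parameters are such that the weights are well defined and all moments $\rho^{(a)}_m=\sum_{k\ge0}k^mw^{(a)}(k)$ converge absolutely. Moment matrix: $\mathscr M_{n,pl+a-1}=\rho^{(a)}_{n+l}$ for $n,l\in\mathbb N_0$. It is assumed that all leading principal minors of $\mathscr M$ are nonzero (for the original and the shifted parameters), so that there is a unique Gauss--Borel factorization $\mathscr M=S^{-1}H\tilde S^{-\top}$ with $S,\tilde S$ lower unitriangular and $H$ diagonal. $T=S\Lambda S^{-1}=H\tilde S^{-\top}(\Lambda^\top)^p\tilde S^\top H^{-1}$. For any quantity $Q$ depending on the parameters and any parameter shift $\Theta$, $\Theta Q$ denotes $Q$ evaluated at the shifted parameters. *)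

theory Defs
  imports Complex_Main "Jordan_Normal_Form.Determinant"
begin

section \<open>Semi-infinite matrices\<close>

type_synonym imat = "nat \<Rightarrow> nat \<Rightarrow> complex"

text \<open>The product of two semi-infinite matrices is only meaningful when every entry is a sum
  with finitely many nonzero terms; an entry with infinitely many nonzero terms gets the junk value
  0. In every product formed below the left factor has finitely supported rows: it is a product of
  diagonal, lower triangular and (upper) banded matrices, or the transpose of a recurrence matrix,
  which is banded.\<close>

definition imul :: "imat \<Rightarrow> imat \<Rightarrow> imat"  (infixl "\<star>" 70) where
  "A \<star> B = (\<lambda>i j. \<Sum>k | A i k * B k j \<noteq> 0. A i k * B k j)"

definition iid :: imat where
  "iid = (\<lambda>i j. if i = j then 1 else 0)"

definition iadd :: "imat \<Rightarrow> imat \<Rightarrow> imat" where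
  "iadd A B = (\<lambda>i j. A i j + B i j)"

definition iscale :: "complex \<Rightarrow> imat \<Rightarrow> imat" where
  "iscale x A = (\<lambda>i j. x * A i j)"

definition itr :: "imat \<Rightarrow> imat" where
  "itr A = (\<lambda>i j. A j i)"

primrec ipow :: "imat \<Rightarrow> nat \<Rightarrow> imat" where
  "ipow A 0 = iid"
| "ipow A (Suc n) = A \<star> ipow A n"

definition lower_tri :: "imat \<Rightarrow> bool" where
  "lower_tri A \<longleftrightarrow> (\<forall>i j. i < j \<longrightarrow> A i j = 0)"

definition lower_unitri :: "imat \<Rightarrow> bool" where
  "lower_unitri A \<longleftrightarrow> lower_tri A \<and> (\<forall>i. A i i = 1)"

definition diagonal :: "imat \<Rightarrow> bool" where
  "diagonal A \<longleftrightarrow> (\<forall>i j. i \<noteq> j \<longrightarrow> A i j = 0)"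

text \<open>The inverse of a lower triangular (in particular, of a diagonal) matrix without zeros on the
  diagonal. Requiring the inverse to be lower triangular makes both products finite sums.\<close>

definition iinv :: "imat \<Rightarrow> imat" where
  "iinv A = (THE B. lower_tri B \<and> A \<star> B = iid \<and> B \<star> A = iid)"

definition Lam :: imat where
  "Lam = (\<lambda>i j. if j = i + 1 then 1 else 0)"

definition Iproj :: "nat \<Rightarrow> nat \<Rightarrow> imat" where
  "Iproj p a = (\<lambda>i j. if i = j \<and> i mod p = (a - 1) mod p then 1 else 0)"

definition Lam_a :: "nat \<Rightarrow> nat \<Rightarrow> imat" where
  "Lam_a p a = ipow Lam p \<star> Iproj p a"


section \<open>Hypergeometric weights and their moment matrix\<close>

text \<open>The indices of \<open>num_len\<close>, \<open>bpar\<close>, \<open>cpar\<close>, \<open>etapar\<close> start at 1: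
  \<open>bpar P a j\<close> is $b^{(a)}_j$ for $1 \le a \le p$ and $1 \le j \le M^{(a)}$, where
  \<open>nweights P\<close> is $p$, \<open>num_len P a\<close> is $M^{(a)}$ and \<open>den_len P\<close> is $N$.
  Values outside these ranges are never used.\<close>

record params =
  nweights :: nat
  num_len :: "nat \<Rightarrow> nat"
  den_len :: nat
  bpar :: "nat \<Rightarrow> nat \<Rightarrow> complex"
  cpar :: "nat \<Rightarrow> complex"
  etapar :: "nat \<Rightarrow> complex"

definition weight :: "params \<Rightarrow> nat \<Rightarrow> nat \<Rightarrow> complex" where
  "weight P a k =
     (\<Prod>j = 1..num_len P a. pochhammer (bpar P a j) k) /
     (\<Prod>j = 1..den_len P. pochhammer (cpar P j) k) * (etapar P a ^ k / fact k)"

definition moment :: "params \<Rightarrow> nat \<Rightarrow> nat \<Rightarrow> complex" where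
  "moment P a m = (\<Sum>k. of_nat k ^ m * weight P a k)"

text \<open>Column \<open>j\<close> is $pl + a - 1$ with $a = (j \bmod p) + 1$ and $l = \lfloor j / p \rfloor$.\<close>

definition moment_matrix :: "params \<Rightarrow> imat" where
  "moment_matrix P =
     (\<lambda>n j. moment P (j mod nweights P + 1) (n + j div nweights P))"

definition weights_well_defined :: "params \<Rightarrow> bool" where
  "weights_well_defined P \<longleftrightarrow>
     (\<forall>j\<in>{1..den_len P}. \<forall>k. pochhammer (cpar P j) k \<noteq> 0)"

definition moments_converge :: "params \<Rightarrow> bool" where
  "moments_converge P \<longleftrightarrow>
     (\<forall>a\<in>{1..nweights P}. \<forall>m. summable (\<lambda>k. norm (of_nat k ^ m * weight P a k)))"

definition minors_nonzero :: "params \<Rightarrow> bool" where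
  "minors_nonzero P \<longleftrightarrow>
     (\<forall>n. det (mat n n (\<lambda>(i, j). moment_matrix P i j)) \<noteq> 0)"

definition admissible :: "params \<Rightarrow> bool" where
  "admissible P \<longleftrightarrow> weights_well_defined P \<and> moments_converge P \<and> minors_nonzero P"


section \<open>Gauss--Borel factorization and recurrence matrix\<close>

definition gauss_borel :: "imat \<Rightarrow> imat \<times> imat \<times> imat \<Rightarrow> bool" where
  "gauss_borel A = (\<lambda>(S, H, St).
     lower_unitri S \<and> diagonal H \<and> lower_unitri St \<and> A = iinv S \<star> H \<star> itr (iinv St))"

definition GB :: "params \<Rightarrow> imat \<times> imat \<times> imat" where
  "GB P = (THE F. gauss_borel (moment_matrix P) F)"

definition Smat :: "params \<Rightarrow> imat" where
  "Smat P = fst (GB P)"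

definition Hmat :: "params \<Rightarrow> imat" where
  "Hmat P = fst (snd (GB P))"

definition Stmat :: "params \<Rightarrow> imat" where
  "Stmat P = snd (snd (GB P))"

definition Tmat :: "params \<Rightarrow> imat" where
  "Tmat P = Smat P \<star> Lam \<star> iinv (Smat P)"


section \<open>Parameter shifts and connection matrices\<close>

definition shift_b :: "nat \<Rightarrow> nat \<Rightarrow> params \<Rightarrow> params" where
  "shift_b a r P = P\<lparr>bpar := (bpar P)(a := (bpar P a)(r := bpar P a r + 1))\<rparr>"

definition shift_c :: "nat \<Rightarrow> params \<Rightarrow> params" where
  "shift_c s P = P\<lparr>cpar := (cpar P)(s := cpar P s - 1)\<rparr>"

definition omega_b :: "params \<Rightarrow> nat \<Rightarrow> nat \<Rightarrow> imat" where
  "omega_b P a r =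
     iinv (Hmat (shift_b a r P)) \<star> Stmat (shift_b a r P)
       \<star> iadd (Lam_a (nweights P) a) (iscale (bpar P a r) iid)
       \<star> iinv (Stmat P) \<star> Hmat P"

definition omega_c :: "params \<Rightarrow> nat \<Rightarrow> imat" where
  "omega_c P s =
     iinv (Hmat (shift_c s P)) \<star> Stmat (shift_c s P)
       \<star> iadd (ipow Lam (nweights P)) (iscale (cpar P s - 1) iid)
       \<star> iinv (Stmat P) \<star> Hmat P"

end

theory Submission
  imports Defs
begin

text \<open>Multiplying a weight by an affine function of \<open>k\<close> is what each parameter shift does, up to a
  scalar \<open>x\<close>, so the shifted moment matrix satisfies $x \mathscr M' = \mathscr M A^\top$ with \<open>A\<close> the
  banded middle factor of \<open>\<omega>\<close>. Inserting the two Gauss--Borel factorizations yields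
  $\omega = x\, S'^{-\top} S^\top$, and then $T'^\top\omega = x\, S'^{-\top}\Lambda^\top S^\top = \omega T^\top$.
  This last expression also shows that \<open>\<omega>\<close> is upper triangular, so that all products in the final
  computation have finitely supported columns.\<close>

section \<open>Algebra of semi-infinite matrices\<close>

text \<open>The junk value 0 of infinite sums breaks associativity in general. It is recovered below
  from finite rows and, as \<open>row_finite (itr A)\<close>, finite columns.\<close>

definition row_finite :: "imat \<Rightarrow> bool" where
  "row_finite A \<longleftrightarrow> (\<forall>i. finite {k. A i k \<noteq> 0})"

lemma imul_eq_sum:
  assumes "finite K" and "\<And>k. k \<notin> K \<Longrightarrow> A i k * B k j = 0"
  shows "(A \<star> B) i j = (\<Sum>k\<in>K. A i k * B k j)"
  unfolding imul_def by (rule sum.mono_neutral_left) (use assms in auto)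

lemma itr_itr [simp]: "itr (itr A) = A"
  by (simp add: itr_def)

lemma itr_imul: "itr (A \<star> B) = itr B \<star> itr A"
  by (simp add: itr_def imul_def mult.commute)

lemma itr_iid [simp]: "itr iid = iid"
  by (auto simp: itr_def iid_def intro!: ext)

lemma itr_iscale [simp]: "itr (iscale x A) = iscale x (itr A)"
  by (simp add: itr_def iscale_def)

lemma iid_imul [simp]: "iid \<star> A = A"
proof (intro ext)
  fix i j
  have "(iid \<star> A) i j = (\<Sum>k\<in>{i}. iid i k * A k j)"
    by (rule imul_eq_sum) (auto simp: iid_def)
  then show "(iid \<star> A) i j = A i j" by (simp add: iid_def)
qed

lemma imul_iid [simp]: "A \<star> iid = A"
  using itr_imul[of "itr iid" "itr A"] by simp

lemma iscale_imul: "iscale x A \<star> B = iscale x (A \<star> B)"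
  \<comment> \<open>The index set of the sum consists of the nonzero products. A nonzero factor
    preserves it, whereas 0 empties it, hence the case split.\<close>
  by (cases "x = 0") (auto simp: iscale_def imul_def sum_distrib_left mult.assoc intro!: ext)

lemma imul_iscale: "A \<star> iscale x B = iscale x (A \<star> B)"
  using itr_imul[of "iscale x (itr B)" "itr A"] by (simp add: iscale_imul itr_imul)

lemma row_finite_imul:
  assumes "row_finite A" and "row_finite B"
  shows "row_finite (A \<star> B)"
  unfolding row_finite_def
proof
  fix i
  have "{j. (A \<star> B) i j \<noteq> 0} \<subseteq> (\<Union>k\<in>{k. A i k \<noteq> 0}. {j. B k j \<noteq> 0})"
  proof
    fix j assume "j \<in> {j. (A \<star> B) i j \<noteq> 0}"
    then have "(\<Sum>k | A i k * B k j \<noteq> 0. A i k * B k j) \<noteq> 0"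
      by (simp add: imul_def)
    then obtain k where "k \<in> {k. A i k * B k j \<noteq> 0}" and "A i k * B k j \<noteq> 0"
      by (rule sum.not_neutral_contains_not_neutral)
    then show "j \<in> (\<Union>k\<in>{k. A i k \<noteq> 0}. {j. B k j \<noteq> 0})" by auto
  qed
  then show "finite {j. (A \<star> B) i j \<noteq> 0}"
    by (rule finite_subset) (use assms in \<open>auto simp: row_finite_def\<close>)
qed

text \<open>Row \<open>i\<close> of \<open>A\<close> has finite support \<open>K\<close>, and the
  rows of \<open>B\<close> indexed by \<open>K\<close> live on a common finite set \<open>L\<close>.
  Both bracketings are then the same double sum over \<open>K\<close> and \<open>L\<close>.\<close>

lemma imul_assoc_rows:
  assumes A: "row_finite A" and B: "row_finite B"
  shows "A \<star> B \<star> C = A \<star> (B \<star> C)"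
proof (intro ext)
  fix i j
  define K where "K = {k. A i k \<noteq> 0}"
  define L where "L = (\<Union>k\<in>K. {l. B k l \<noteq> 0})"
  have K: "finite K" and L: "finite L"
    using A B by (auto simp: K_def L_def row_finite_def)
  have AB: "(A \<star> B) i l = (\<Sum>k\<in>K. A i k * B k l)" for l
    by (rule imul_eq_sum[OF K]) (auto simp: K_def)
  have "(A \<star> B \<star> C) i j = (\<Sum>l\<in>L. (A \<star> B) i l * C l j)"
  proof (rule imul_eq_sum[OF L])
    fix l assume "l \<notin> L"
    then show "(A \<star> B) i l * C l j = 0" by (simp add: AB L_def)
  qed
  also have "\<dots> = (\<Sum>k\<in>K. A i k * (\<Sum>l\<in>L. B k l * C l j))"
    unfolding AB sum_distrib_right sum_distrib_left
    by (subst sum.swap) (simp add: mult.assoc)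
  also have "\<dots> = (\<Sum>k\<in>K. A i k * (B \<star> C) k j)"
  proof (rule sum.cong[OF refl])
    fix k assume "k \<in> K"
    then have "(B \<star> C) k j = (\<Sum>l\<in>L. B k l * C l j)"
      by (intro imul_eq_sum[OF L]) (auto simp: L_def)
    then show "A i k * (\<Sum>l\<in>L. B k l * C l j) = A i k * (B \<star> C) k j" by simp
  qed
  also have "\<dots> = (A \<star> (B \<star> C)) i j"
    by (rule imul_eq_sum[OF K, symmetric]) (auto simp: K_def)
  finally show "(A \<star> B \<star> C) i j = (A \<star> (B \<star> C)) i j" .
qed

lemma imul_cancel_left:
  assumes "row_finite A" and "row_finite B" and "A \<star> B = iid"
  shows "A \<star> (B \<star> C) = C"
  using imul_assoc_rows[OF assms(1,2), of C] assms(3) by simp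

lemma imul_assoc_cols:
  assumes "row_finite (itr B)" and "row_finite (itr C)"
  shows "A \<star> B \<star> C = A \<star> (B \<star> C)"
  using imul_assoc_rows[OF assms(2,1), of "itr A"] by (metis itr_imul itr_itr)

text \<open>The support of a row of \<open>A\<close> and that of a column of \<open>C\<close> cut
  the double sum to a finite rectangle. This handles a full matrix, such as the moment matrix,
  between a lower and an upper triangular one.\<close>

lemma imul_assoc_row_col:
  assumes A: "row_finite A" and C: "row_finite (itr C)"
  shows "A \<star> B \<star> C = A \<star> (B \<star> C)"
proof (intro ext)
  fix i j
  define K where "K = {k. A i k \<noteq> 0}"
  define L where "L = {l. C l j \<noteq> 0}"
  have K: "finite K" and L: "finite L"
    using A C by (auto simp: K_def L_def row_finite_def itr_def)
  have AB: "(A \<star> B) i l = (\<Sum>k\<in>K. A i k * B k l)" for l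
    by (rule imul_eq_sum[OF K]) (auto simp: K_def)
  have BC: "(B \<star> C) k j = (\<Sum>l\<in>L. B k l * C l j)" for k
    by (rule imul_eq_sum[OF L]) (auto simp: L_def)
  have "(A \<star> B \<star> C) i j = (\<Sum>l\<in>L. (A \<star> B) i l * C l j)"
    by (rule imul_eq_sum[OF L]) (auto simp: L_def)
  also have "\<dots> = (\<Sum>k\<in>K. A i k * (B \<star> C) k j)"
    unfolding AB BC sum_distrib_right sum_distrib_left
    by (subst sum.swap) (simp add: mult.assoc)
  also have "\<dots> = (A \<star> (B \<star> C)) i j"
    by (rule imul_eq_sum[OF K, symmetric]) (auto simp: K_def)
  finally show "(A \<star> B \<star> C) i j = (A \<star> (B \<star> C)) i j" .
qed


section \<open>Triangular matrices\<close>

lemma lower_tri_row_finite: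
  assumes "lower_tri A"
  shows "row_finite A"
proof -
  have "{k. A i k \<noteq> 0} \<subseteq> {..i}" for i
    using assms by (auto simp: lower_tri_def intro: leI)
  then show ?thesis unfolding row_finite_def by (meson finite_atMost finite_subset)
qed

lemma lower_unitri_lower_tri: "lower_unitri A \<Longrightarrow> lower_tri A"
  by (simp add: lower_unitri_def)

lemma diagonal_lower_tri: "diagonal A \<Longrightarrow> lower_tri A"
  by (simp add: diagonal_def lower_tri_def)

lemma itr_diagonal: "diagonal A \<Longrightarrow> itr A = A"
  unfolding diagonal_def itr_def by (intro ext) metis

lemma diagonal_iff: "diagonal A \<longleftrightarrow> lower_tri A \<and> lower_tri (itr A)"
  by (auto simp: diagonal_def lower_tri_def itr_def nat_neq_iff)

lemma lower_tri_imul_entry: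
  assumes "lower_tri A"
  shows "(A \<star> B) i j = (\<Sum>k\<le>i. A i k * B k j)"
  using assms by (intro imul_eq_sum) (auto simp: lower_tri_def)

lemma lower_tri_imul:
  assumes "lower_tri A" and "lower_tri B"
  shows "lower_tri (A \<star> B)"
  using assms(2) by (auto simp: lower_tri_def lower_tri_imul_entry[OF assms(1)] intro!: sum.neutral)

lemma lower_tri_imul_diag:
  assumes "lower_tri A" and "lower_tri B"
  shows "(A \<star> B) i i = A i i * B i i"
proof -
  have "(A \<star> B) i i = (\<Sum>k\<in>{i}. A i k * B k i)"
  proof (rule imul_eq_sum)
    fix k assume "k \<notin> {i}"
    then have "i < k \<or> k < i" by auto
    then show "A i k * B k i = 0" using assms by (auto simp: lower_tri_def)
  qed simp
  then show ?thesis by simp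
qed

text \<open>Uniqueness is the usual C = C(AB) = (CA)B = B, where triangularity provides the
  associativity.\<close>

lemma iinv_eqI:
  assumes "lower_tri A" "lower_tri B" "A \<star> B = iid" "B \<star> A = iid"
  shows "iinv A = B"
  unfolding iinv_def
proof (rule the_equality)
  show "lower_tri B \<and> A \<star> B = iid \<and> B \<star> A = iid" using assms by simp
next
  fix C assume C: "lower_tri C \<and> A \<star> C = iid \<and> C \<star> A = iid"
  then have "C \<star> A \<star> B = C \<star> (A \<star> B)"
    using assms(1) by (intro imul_assoc_rows lower_tri_row_finite) auto
  then show "C = B" using C assms(3) by simp
qed

section \<open>Elimination for matrices with nonzero leading minors\<close>

text \<open>Detached from the parameters so that it also applies to transposes and to unitriangular
  matrices.\<close>

definition leading_minors_nonzero :: "imat \<Rightarrow> bool" where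
  "leading_minors_nonzero M \<longleftrightarrow> (\<forall>n. det (mat n n (\<lambda>(i, j). M i j)) \<noteq> 0)"

text \<open>For row systems x M = v on the leading block, the identity B M = 1 gives solvability and
  M B = 1 gives a trivial kernel.\<close>

lemma leading_block_inverse:
  assumes "leading_minors_nonzero M"
  shows "\<exists>B. \<forall>i<n. \<forall>j<n. (\<Sum>k<n. B i k * M k j) = (if i = j then 1 else 0)
      \<and> (\<Sum>k<n. M i k * B k j) = (if i = j then 1 else 0)"
proof -
  define A where "A = mat n n (\<lambda>(i, j). M i j)"
  have A: "A \<in> carrier_mat n n" by (simp add: A_def)
  have "det A \<noteq> 0" using assms by (simp add: A_def leading_minors_nonzero_def)
  from det_non_zero_imp_unit[OF A this] obtain B where
    B: "B \<in> carrier_mat n n" "B * A = 1\<^sub>m n" "A * B = 1\<^sub>m n"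
    unfolding Units_def ring_mat_def by auto
  show ?thesis
  proof (intro exI[of _ "\<lambda>i j. B $$ (i, j)"] allI impI conjI)
    fix i j assume ij: "i < n" "j < n"
    have "(B * A) $$ (i, j) = (\<Sum>k<n. B $$ (i, k) * M k j)"
      using ij B(1) by (simp add: A_def scalar_prod_def lessThan_atLeast0)
    then show "(\<Sum>k<n. B $$ (i, k) * M k j) = (if i = j then 1 else 0)"
      using ij B(2) by simp
    have "(A * B) $$ (i, j) = (\<Sum>k<n. M i k * B $$ (k, j))"
      using ij B(1) by (simp add: A_def scalar_prod_def lessThan_atLeast0)
    then show "(\<Sum>k<n. M i k * B $$ (k, j)) = (if i = j then 1 else 0)"
      using ij B(3) by simp
  qed
qed

lemma leading_block_solve:
  assumes "leading_minors_nonzero M"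
  shows "\<exists>x. \<forall>j<n. (\<Sum>i<n. x i * M i j) = v j"
proof -
  obtain B where
    B: "\<And>i j. i < n \<Longrightarrow> j < n \<Longrightarrow> (\<Sum>k<n. B i k * M k j) = (if i = j then 1 else 0)"
    using leading_block_inverse[OF assms, of n] by auto
  show ?thesis
  proof (intro exI allI impI)
    fix j assume j: "j < n"
    \<comment> \<open>The solution is the row vector v B.\<close>
    have "(\<Sum>i<n. (\<Sum>l<n. v l * B l i) * M i j) = (\<Sum>l<n. v l * (\<Sum>i<n. B l i * M i j))"
      unfolding sum_distrib_right sum_distrib_left by (subst sum.swap) (simp add: mult.assoc)
    also have "\<dots> = (\<Sum>l<n. if l = j then v l else 0)"
      using j by (intro sum.cong) (auto simp: B)
    also have "\<dots> = v j" using j by simp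
    finally show "(\<Sum>i<n. (\<Sum>l<n. v l * B l i) * M i j) = v j" .
  qed
qed

lemma leading_block_kernel:
  assumes "leading_minors_nonzero M"
    and x: "\<And>j. j < n \<Longrightarrow> (\<Sum>i<n. x i * M i j) = 0" and "i < n"
  shows "x i = 0"
proof -
  obtain B where
    B: "\<And>i j. i < n \<Longrightarrow> j < n \<Longrightarrow> (\<Sum>k<n. M i k * B k j) = (if i = j then 1 else 0)"
    using leading_block_inverse[OF assms(1), of n] by auto
  have "x i = (\<Sum>l<n. if l = i then x l else 0)" using \<open>i < n\<close> by simp
  also have "\<dots> = (\<Sum>l<n. x l * (\<Sum>k<n. M l k * B k i))"
    using \<open>i < n\<close> by (intro sum.cong) (auto simp: B)
  also have "\<dots> = (\<Sum>k<n. (\<Sum>l<n. x l * M l k) * B k i)"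
    unfolding sum_distrib_right sum_distrib_left by (subst sum.swap) (simp add: mult.assoc)
  also have "\<dots> = 0" using x by simp
  finally show ?thesis .
qed

text \<open>The entries of row \<open>n\<close> of \<open>S\<close> left of the diagonal must clear
  the first \<open>n\<close> entries of row \<open>n\<close> of the product. This is a linear system
  for the leading block of size \<open>n\<close>.\<close>

lemma elimination_exists:
  assumes "leading_minors_nonzero M"
  obtains S where "lower_unitri S" and "lower_tri (itr (S \<star> M))"
proof -
  have "\<forall>n. \<exists>x. \<forall>j<n. (\<Sum>i<n. x i * M i j) = - M n j"
    by (intro allI leading_block_solve assms)
  from choice[OF this] obtain X
    where X: "\<And>n j. j < n \<Longrightarrow> (\<Sum>i<n. X n i * M i j) = - M n j"
    by auto
  define S where "S = (\<lambda>n i. if i < n then X n i else if i = n then 1 else 0 :: complex)"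
  have S: "lower_unitri S" by (auto simp: S_def lower_unitri_def lower_tri_def)
  have "(S \<star> M) n j = 0" if "j < n" for n j
  proof -
    have "(S \<star> M) n j = (\<Sum>k\<le>n. S n k * M k j)"
      by (rule lower_tri_imul_entry[OF lower_unitri_lower_tri[OF S]])
    also have "\<dots> = (\<Sum>k<n. S n k * M k j) + M n j"
      by (simp add: S_def flip: lessThan_Suc_atMost)
    also have "(\<Sum>k<n. S n k * M k j) = (\<Sum>k<n. X n k * M k j)"
      by (intro sum.cong) (auto simp: S_def)
    finally show ?thesis using X[OF that] by simp
  qed
  then have "lower_tri (itr (S \<star> M))" by (simp add: lower_tri_def itr_def)
  with S show thesis by (rule that)
qed

text \<open>The unit diagonals cancel in the difference of the two rows \<open>n\<close>, leaving a
  vector in the left kernel of the leading block of size \<open>n\<close>.\<close>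

lemma elimination_unique:
  assumes M: "leading_minors_nonzero M"
    and S: "lower_unitri S" "lower_tri (itr (S \<star> M))"
    and R: "lower_unitri R" "lower_tri (itr (R \<star> M))"
  shows "S = R"
proof (intro ext)
  fix n i
  have low: "lower_tri S" "lower_tri R" using S R by (auto simp: lower_unitri_def)
  have "S n i - R n i = 0" if "i < n"
  proof (rule leading_block_kernel[OF M _ that, of "\<lambda>i. S n i - R n i"])
    fix j assume j: "j < n"
    have "(S \<star> M) n j = 0" "(R \<star> M) n j = 0"
      using S(2) R(2) j by (auto simp: lower_tri_def itr_def)
    then have "(\<Sum>k\<le>n. S n k * M k j) - (\<Sum>k\<le>n. R n k * M k j) = 0"
      by (simp add: lower_tri_imul_entry low)
    then show "(\<Sum>k<n. (S n k - R n k) * M k j) = 0"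
      using S(1) R(1)
      by (simp add: lower_unitri_def left_diff_distrib sum_subtractf flip: lessThan_Suc_atMost)
  qed
  moreover have "S n i = R n i" if "\<not> i < n"
    using that S(1) R(1) by (cases "i = n") (auto simp: lower_unitri_def lower_tri_def)
  ultimately show "S n i = R n i" by fastforce
qed

text \<open>With a zero pivot, row \<open>n\<close> of \<open>S\<close> would lie in the left kernel
  of the block of size n + 1, contradicting its diagonal entry 1.\<close>

lemma elimination_pivot:
  assumes M: "leading_minors_nonzero M"
    and S: "lower_unitri S" "lower_tri (itr (S \<star> M))"
  shows "(S \<star> M) n n \<noteq> 0"
proof
  assume nn: "(S \<star> M) n n = 0"
  have "S n n = 0"
  proof (rule leading_block_kernel[OF M, where n = "Suc n" and x = "S n"])
    fix j assume "j < Suc n"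
    then have "(S \<star> M) n j = 0"
      using nn S(2) by (auto simp: lower_tri_def itr_def less_Suc_eq)
    then show "(\<Sum>i<Suc n. S n i * M i j) = 0"
      using S(1) by (simp add: lower_tri_imul_entry lower_unitri_def lessThan_Suc_atMost
          del: sum.lessThan_Suc)
  qed simp
  then show False using S(1) by (simp add: lower_unitri_def)
qed

section \<open>Inverses of unitriangular and diagonal matrices\<close>

lemma leading_minors_nonzero_lower_unitri:
  assumes "lower_unitri S"
  shows "leading_minors_nonzero S"
  unfolding leading_minors_nonzero_def
proof
  fix n
  have "det (mat n n (\<lambda>(i, j). S i j)) = prod_list (diag_mat (mat n n (\<lambda>(i, j). S i j)))"
    by (rule det_lower_triangular[of n])
      (use assms in \<open>auto simp: lower_unitri_def lower_tri_def\<close>)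
  also have "diag_mat (mat n n (\<lambda>(i, j). S i j)) = map (\<lambda>i. 1) [0..<n]"
    using assms by (auto simp: diag_mat_def lower_unitri_def)
  finally show "det (mat n n (\<lambda>(i, j). S i j)) \<noteq> 0" by (simp add: map_replicate_const)
qed

text \<open>Elimination applied to \<open>S\<close> itself leaves a unitriangular matrix that is upper as well as
  lower triangular.\<close>

lemma lower_unitri_left_inverse:
  assumes S: "lower_unitri S"
  obtains B where "lower_unitri B" and "B \<star> S = iid"
proof -
  obtain B where B: "lower_unitri B" "lower_tri (itr (B \<star> S))"
    using elimination_exists[OF leading_minors_nonzero_lower_unitri[OF S]] .
  have low: "lower_tri B" "lower_tri S" using B S by (auto simp: lower_unitri_def)
  have "diagonal (B \<star> S)"
    using B(2) lower_tri_imul[OF low] by (simp add: diagonal_iff)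
  moreover have "(B \<star> S) i i = 1" for i
    using lower_tri_imul_diag[OF low] B(1) S by (simp add: lower_unitri_def)
  ultimately have "B \<star> S = iid" by (auto simp: diagonal_def iid_def intro!: ext)
  with B(1) show thesis by (rule that)
qed

text \<open>The left inverse \<open>B\<close> of \<open>S\<close> has itself a left inverse
  \<open>C\<close>. Then C = C(BS) = S, so \<open>B\<close> is a two-sided inverse.\<close>

lemma iinv_lower_unitri:
  assumes S: "lower_unitri S"
  shows "lower_unitri (iinv S)" and "iinv S \<star> S = iid" and "S \<star> iinv S = iid"
proof -
  obtain B where B: "lower_unitri B" "B \<star> S = iid"
    using lower_unitri_left_inverse[OF S] .
  obtain C where C: "lower_unitri C" "C \<star> B = iid"
    using lower_unitri_left_inverse[OF B(1)] .
  have "C \<star> B \<star> S = C \<star> (B \<star> S)"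
    using B C by (intro imul_assoc_rows lower_tri_row_finite lower_unitri_lower_tri)
  then have "C = S" using B C by simp
  then have SB: "S \<star> B = iid" using C by simp
  have "iinv S = B"
    by (rule iinv_eqI) (use S B SB in \<open>auto simp: lower_unitri_lower_tri\<close>)
  then show "lower_unitri (iinv S)" "iinv S \<star> S = iid" "S \<star> iinv S = iid"
    using B SB by simp_all
qed

lemma iinv_diagonal:
  assumes H: "diagonal H" and nz: "\<And>i. H i i \<noteq> 0"
  shows "diagonal (iinv H)" and "iinv H \<star> H = iid"
proof -
  define B where "B = (\<lambda>i j. if i = j then 1 / H i i else 0)"
  have B: "diagonal B" by (simp add: B_def diagonal_def)
  have *: "X \<star> Y = iid"
    if X: "diagonal X" and Y: "diagonal Y" and "\<And>i. X i i * Y i i = 1" for X Y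
  proof -
    have "diagonal (X \<star> Y)"
      using X Y by (simp add: diagonal_iff lower_tri_imul itr_imul)
    moreover have "(X \<star> Y) i i = 1" for i
      using that by (simp add: lower_tri_imul_diag diagonal_lower_tri)
    ultimately show ?thesis by (auto simp: diagonal_def iid_def intro!: ext)
  qed
  have HB: "H \<star> B = iid" and BH: "B \<star> H = iid"
    by (intro * H B; use nz in \<open>simp add: B_def\<close>)+
  have "iinv H = B"
    by (rule iinv_eqI) (use H B HB BH in \<open>auto simp: diagonal_lower_tri\<close>)
  then show "diagonal (iinv H)" "iinv H \<star> H = iid" using B BH by simp_all
qed


section \<open>Gauss--Borel factorization\<close>

lemma leading_minors_nonzero_itr:
  assumes "leading_minors_nonzero M"
  shows "leading_minors_nonzero (itr M)"
  unfolding leading_minors_nonzero_def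
proof
  fix n
  have "mat n n (\<lambda>(i, j). itr M i j) = transpose_mat (mat n n (\<lambda>(i, j). M i j))"
    by (auto simp: itr_def)
  then have "det (mat n n (\<lambda>(i, j). itr M i j)) = det (mat n n (\<lambda>(i, j). M i j))"
    by (simp add: det_transpose[of _ n])
  then show "det (mat n n (\<lambda>(i, j). itr M i j)) \<noteq> 0"
    using assms by (simp add: leading_minors_nonzero_def)
qed

text \<open>Transposition exchanges the two unitriangular factors and fixes \<open>H\<close>, so
  facts about the left factor carry over to the right one.\<close>

lemma gauss_borel_itr:
  assumes "gauss_borel M (S, H, R)"
  shows "itr M = iinv R \<star> (H \<star> itr (iinv S))" and "gauss_borel (itr M) (R, H, S)"
proof -
  have H: "diagonal H" and R: "lower_unitri R" and S: "lower_unitri S"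
    and M: "M = iinv S \<star> H \<star> itr (iinv R)"
    using assms by (auto simp: gauss_borel_def)
  show *: "itr M = iinv R \<star> (H \<star> itr (iinv S))"
    unfolding M by (simp add: itr_imul itr_diagonal[OF H])
  show "gauss_borel (itr M) (R, H, S)"
    unfolding gauss_borel_def * using H R S
    by (simp add: imul_assoc_rows lower_tri_row_finite lower_unitri_lower_tri
        diagonal_lower_tri iinv_lower_unitri)
qed

text \<open>Identifies the left factor of any factorization as an elimination matrix, which brings
  in the uniqueness and pivot results. The last equation recovers \<open>H\<close> from the outer
  factors.\<close>

lemma gauss_borel_elimination:
  assumes "gauss_borel M (S, H, R)"
  shows "S \<star> M = H \<star> itr (iinv R)"
    and "lower_tri (itr (S \<star> M))"
    and "H = S \<star> M \<star> itr R"
proof -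
  have H: "diagonal H" and R: "lower_unitri R" and S: "lower_unitri S"
    and M: "M = iinv S \<star> H \<star> itr (iinv R)"
    using assms by (auto simp: gauss_borel_def)
  note low = iinv_lower_unitri[OF R] iinv_lower_unitri[OF S]
  note fin = lower_tri_row_finite lower_unitri_lower_tri diagonal_lower_tri row_finite_imul
  have "M = iinv S \<star> (H \<star> itr (iinv R))"
    unfolding M by (rule imul_assoc_rows) (use H low in \<open>auto intro: fin\<close>)
  then show SM: "S \<star> M = H \<star> itr (iinv R)"
    using S low by (simp add: imul_cancel_left fin)
  show "lower_tri (itr (S \<star> M))"
    unfolding SM itr_imul itr_itr itr_diagonal[OF H]
    using H low by (intro lower_tri_imul) (simp_all add: lower_unitri_lower_tri diagonal_lower_tri)
  have "H \<star> itr (iinv R) \<star> itr R = H \<star> (itr (iinv R) \<star> itr R)"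
    by (rule imul_assoc_cols) (use R low in \<open>auto intro: fin\<close>)
  also have "\<dots> = H" using low by (simp flip: itr_imul)
  finally show "H = S \<star> M \<star> itr R" unfolding SM by simp
qed

text \<open>\<open>H n n\<close> is a factor of the elimination pivot, which is nonzero.\<close>

lemma gauss_borel_pivot:
  assumes "leading_minors_nonzero M" and "gauss_borel M (S, H, R)"
  shows "H n n \<noteq> 0"
proof -
  have H: "diagonal H" and R: "lower_unitri R" and S: "lower_unitri S"
    using assms by (auto simp: gauss_borel_def)
  have "(S \<star> M) n n = H n n * iinv R n n"
  proof -
    have "(S \<star> M) n n = itr (H \<star> itr (iinv R)) n n"
      using gauss_borel_elimination(1)[OF assms(2)] by (simp add: itr_def)
    also have "\<dots> = (iinv R \<star> H) n n" by (simp add: itr_imul itr_diagonal[OF H])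
    also have "\<dots> = iinv R n n * H n n"
      using H iinv_lower_unitri(1)[OF R]
      by (intro lower_tri_imul_diag) (simp_all add: lower_unitri_lower_tri diagonal_lower_tri)
    finally show ?thesis by simp
  qed
  with elimination_pivot[OF assms(1) S gauss_borel_elimination(2)[OF assms(2)]]
  show ?thesis by fastforce
qed

text \<open>Eliminate in \<open>M\<close> to get \<open>S\<close> and in its transpose to get
  \<open>R\<close>. Of the two bracketings of \<open>S\<close> times \<open>M\<close> times the
  transpose of \<open>R\<close>, one shows the product to be lower triangular and the other upper
  triangular, so it is diagonal.\<close>

lemma gauss_borel_exists:
  assumes M: "leading_minors_nonzero M"
  obtains S H R where "gauss_borel M (S, H, R)"
proof -
  obtain S where S: "lower_unitri S" "lower_tri (itr (S \<star> M))"
    using elimination_exists[OF M] .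
  obtain R where R: "lower_unitri R" "lower_tri (itr (R \<star> itr M))"
    using elimination_exists[OF leading_minors_nonzero_itr[OF M]] .
  define H where "H = S \<star> M \<star> itr R"
  note low = iinv_lower_unitri[OF R(1)] iinv_lower_unitri[OF S(1)]
  note fin = lower_tri_row_finite lower_unitri_lower_tri row_finite_imul
  have H': "H = S \<star> (M \<star> itr R)"
    unfolding H_def by (rule imul_assoc_row_col) (use R S in \<open>auto intro: fin\<close>)
  have "lower_tri (M \<star> itr R)" using R(2) by (simp add: itr_imul)
  then have "lower_tri H"
    unfolding H' using S by (simp add: lower_tri_imul lower_unitri_lower_tri)
  moreover have "lower_tri (itr H)"
    unfolding H_def itr_imul[of "S \<star> M"] itr_itr
    using S R by (simp add: lower_tri_imul lower_unitri_lower_tri)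
  ultimately have H: "diagonal H" by (simp add: diagonal_iff)
  have "H \<star> itr (iinv R) = S \<star> M \<star> (itr R \<star> itr (iinv R))"
    unfolding H_def by (rule imul_assoc_cols) (use R low in \<open>auto intro: fin\<close>)
  also have "\<dots> = S \<star> M" using low by (simp flip: itr_imul)
  finally have HR: "H \<star> itr (iinv R) = S \<star> M" .
  have "iinv S \<star> H \<star> itr (iinv R) = iinv S \<star> (H \<star> itr (iinv R))"
    by (rule imul_assoc_rows) (use low H in \<open>auto intro: fin diagonal_lower_tri\<close>)
  also have "\<dots> = iinv S \<star> S \<star> M"
    unfolding HR by (rule imul_assoc_rows[symmetric]) (use low S in \<open>auto intro: fin\<close>)
  also have "\<dots> = M" using low by simp
  finally have "gauss_borel M (S, H, R)"
    using S R H by (simp add: gauss_borel_def)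
  then show thesis by (rule that)
qed

lemma gauss_borel_unique:
  assumes M: "leading_minors_nonzero M"
    and 1: "gauss_borel M (S, H, R)" and 2: "gauss_borel M (S', H', R')"
  shows "S = S' \<and> H = H' \<and> R = R'"
proof -
  have *: "A = A'" if N: "leading_minors_nonzero N"
    and 1: "gauss_borel N (A, D, B)" and 2: "gauss_borel N (A', D', B')" for N A D B A' D' B'
  proof (rule elimination_unique[OF N])
    show "lower_unitri A" "lower_unitri A'" using 1 2 by (simp_all add: gauss_borel_def)
    show "lower_tri (itr (A \<star> N))" by (rule gauss_borel_elimination(2)[OF 1])
    show "lower_tri (itr (A' \<star> N))" by (rule gauss_borel_elimination(2)[OF 2])
  qed
  have "S = S'" by (rule *[OF M 1 2])
  moreover have "R = R'"
    by (rule *[OF leading_minors_nonzero_itr[OF M] gauss_borel_itr(2)[OF 1] gauss_borel_itr(2)[OF 2]])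
  ultimately show ?thesis
    using gauss_borel_elimination(3)[OF 1] gauss_borel_elimination(3)[OF 2] by simp
qed

text \<open>Existence and uniqueness together make the definite description in \<open>GB_def\<close>
  meaningful.\<close>

lemma gauss_borel_GB:
  assumes "minors_nonzero P"
  shows "gauss_borel (moment_matrix P) (Smat P, Hmat P, Stmat P)"
proof -
  have M: "leading_minors_nonzero (moment_matrix P)"
    using assms by (simp add: minors_nonzero_def leading_minors_nonzero_def)
  obtain S H R where 1: "gauss_borel (moment_matrix P) (S, H, R)"
    using gauss_borel_exists[OF M] .
  have "GB P = (S, H, R)"
    unfolding GB_def
  proof (rule the_equality)
    show "gauss_borel (moment_matrix P) (S, H, R)" by (rule 1)
  next
    fix F assume "gauss_borel (moment_matrix P) F"
    then show "F = (S, H, R)"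
      using gauss_borel_unique[OF M 1] by (cases F) auto
  qed
  then show ?thesis using 1 by (simp add: Smat_def Hmat_def Stmat_def)
qed


section \<open>Connection matrices\<close>

lemma row_finite_Lam: "row_finite Lam"
  by (simp add: row_finite_def Lam_def)

text \<open>The computation common to all three shifts. The particular shift enters only through
  \<open>A\<close>, \<open>x\<close> and the relation \<open>shift\<close>.\<close>

lemma connection_intertwines:
  assumes MP: "minors_nonzero P" and MQ: "minors_nonzero Q"
    and A: "row_finite A"
    and shift: "moment_matrix P \<star> itr A = iscale x (moment_matrix Q)"
  defines "W \<equiv> iinv (Hmat Q) \<star> Stmat Q \<star> A \<star> iinv (Stmat P) \<star> Hmat P"
  shows "itr (Tmat Q) \<star> W = W \<star> itr (Tmat P)"
proof -
  note gP = gauss_borel_GB[OF MP] and gQ = gauss_borel_GB[OF MQ]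
  have HP: "diagonal (Hmat P)" and SP: "lower_unitri (Smat P)" and RP: "lower_unitri (Stmat P)"
    using gP by (auto simp: gauss_borel_def)
  have HQ: "diagonal (Hmat Q)" and SQ: "lower_unitri (Smat Q)" and RQ: "lower_unitri (Stmat Q)"
    using gQ by (auto simp: gauss_borel_def)
  have HQi: "diagonal (iinv (Hmat Q))" "iinv (Hmat Q) \<star> Hmat Q = iid"
    using iinv_diagonal[OF HQ gauss_borel_pivot[OF _ gQ]] MQ
    by (auto simp: minors_nonzero_def leading_minors_nonzero_def)
  note inv = iinv_lower_unitri[OF SP] iinv_lower_unitri[OF RP]
    iinv_lower_unitri[OF SQ] iinv_lower_unitri[OF RQ]
  note fin = lower_tri_row_finite lower_unitri_lower_tri diagonal_lower_tri row_finite_imul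
  have rows: "row_finite (Hmat P)" "row_finite (Smat P)" "row_finite (Stmat P)"
    "row_finite (Hmat Q)" "row_finite (Smat Q)" "row_finite (Stmat Q)" "row_finite (iinv (Hmat Q))"
    "row_finite (iinv (Smat P))" "row_finite (iinv (Stmat P))"
    "row_finite (iinv (Smat Q))" "row_finite (iinv (Stmat Q))"
    "row_finite Lam"
    using HP SP RP HQ SQ RQ HQi inv by (auto intro: fin row_finite_Lam)
  have W: "row_finite W"
    unfolding W_def by (intro row_finite_imul rows A)
  have AM: "A \<star> itr (moment_matrix P) = iscale x (itr (moment_matrix Q))"
    using arg_cong[OF shift, of itr] by (simp add: itr_imul)
  \<comment> \<open>Completing the tail of \<open>W\<close> by this factor produces the transposed
    moment matrix of \<open>P\<close>, to which \<open>AM\<close> applies. The factorization for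
    \<open>Q\<close> then cancels against the head of \<open>W\<close>.\<close>
  have "W \<star> itr (iinv (Smat P))
      = iinv (Hmat Q) \<star> Stmat Q \<star> A \<star> (iinv (Stmat P) \<star> (Hmat P \<star> itr (iinv (Smat P))))"
    unfolding W_def by (simp add: imul_assoc_rows row_finite_imul rows A)
  also have "\<dots> = iinv (Hmat Q) \<star> (Stmat Q \<star> (A \<star> itr (moment_matrix P)))"
    by (simp add: imul_assoc_rows row_finite_imul rows A flip: gauss_borel_itr(1)[OF gP])
  also have "\<dots> = iscale x (iinv (Hmat Q) \<star> (Stmat Q \<star>
      (iinv (Stmat Q) \<star> (Hmat Q \<star> itr (iinv (Smat Q))))))"
    unfolding AM gauss_borel_itr(1)[OF gQ] imul_iscale ..
  also have "Stmat Q \<star> (iinv (Stmat Q) \<star> (Hmat Q \<star> itr (iinv (Smat Q))))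
      = Hmat Q \<star> itr (iinv (Smat Q))"
    by (simp add: imul_cancel_left rows inv)
  also have "iinv (Hmat Q) \<star> \<dots> = itr (iinv (Smat Q))"
    by (simp add: imul_cancel_left rows HQi)
  finally have WS: "W \<star> itr (iinv (Smat P)) = iscale x (itr (iinv (Smat Q)))" .
  have cancelP: "itr (iinv (Smat P)) \<star> itr (Smat P) = iid"
    and cancelQ: "itr (Smat Q) \<star> itr (iinv (Smat Q)) = iid"
    using inv by (simp_all flip: itr_imul)
  \<comment> \<open>The middle factor is upper triangular and may have infinite rows, so the mixed
    associativity rule is used: \<open>W\<close> has finite rows and \<open>itr (Smat P)\<close>
    finite columns.\<close>
  have "W = W \<star> (itr (iinv (Smat P)) \<star> itr (Smat P))" by (simp add: cancelP)
  also have "\<dots> = W \<star> itr (iinv (Smat P)) \<star> itr (Smat P)"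
    by (rule imul_assoc_row_col[symmetric]) (simp_all add: W rows)
  finally have W_eq: "W = iscale x (itr (iinv (Smat Q)) \<star> itr (Smat P))"
    unfolding WS iscale_imul .
  have TP: "itr (Tmat P) = itr (iinv (Smat P)) \<star> (itr Lam \<star> itr (Smat P))"
    and TQ: "itr (Tmat Q) = itr (iinv (Smat Q)) \<star> (itr Lam \<star> itr (Smat Q))"
    by (simp_all add: Tmat_def itr_imul)
  \<comment> \<open>In the form \<open>W_eq\<close>, every factor has finite columns, so brackets
    move freely and the two factors from \<open>Smat Q\<close> meet and cancel.\<close>
  have "itr (Tmat Q) \<star> W = iscale x (itr (iinv (Smat Q)) \<star> (itr Lam \<star>
      (itr (Smat Q) \<star> itr (iinv (Smat Q)) \<star> itr (Smat P))))"
    unfolding W_eq TQ imul_iscale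
    by (simp add: imul_assoc_cols itr_imul row_finite_imul rows)
  also have "\<dots> = iscale x (itr (iinv (Smat Q)) \<star> (itr Lam \<star> itr (Smat P)))"
    unfolding cancelQ by simp
  also have "\<dots> = W \<star> itr (iinv (Smat P)) \<star> (itr Lam \<star> itr (Smat P))"
    unfolding WS iscale_imul ..
  also have "\<dots> = W \<star> itr (Tmat P)"
    unfolding TP
    by (rule imul_assoc_row_col) (simp_all add: W itr_imul row_finite_imul rows)
  finally show ?thesis .
qed


section \<open>Parameter shifts of the moments\<close>

text \<open>The factor k raises the moment index by one, and convergence allows the series to be
  split. Keeping \<open>x\<close> on the left avoids dividing by it.\<close>

lemma moment_affine_shift:
  assumes P: "moments_converge P" and Q: "moments_converge Q"
    and p: "nweights Q = nweights P" and a: "a \<in> {1..nweights P}"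
    and w: "\<And>k. x * weight Q a k = (of_nat k + x) * weight P a k"
  shows "x * moment Q a n = moment P a (Suc n) + x * moment P a n"
proof -
  have sP: "summable (\<lambda>k. of_nat k ^ m * weight P a k)" for m
    using P a by (auto simp: moments_converge_def intro: summable_norm_cancel)
  have sQ: "summable (\<lambda>k. of_nat k ^ n * weight Q a k)"
    using Q a p by (auto simp: moments_converge_def intro: summable_norm_cancel)
  have "x * moment Q a n = (\<Sum>k. x * (of_nat k ^ n * weight Q a k))"
    unfolding moment_def by (rule suminf_mult[OF sQ, symmetric])
  also have "\<dots> = (\<Sum>k. of_nat k ^ Suc n * weight P a k + x * (of_nat k ^ n * weight P a k))"
  proof (rule suminf_cong)
    fix k
    have "x * (of_nat k ^ n * weight Q a k) = of_nat k ^ n * (x * weight Q a k)" by simp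
    then show "x * (of_nat k ^ n * weight Q a k)
        = of_nat k ^ Suc n * weight P a k + x * (of_nat k ^ n * weight P a k)"
      unfolding w by (simp add: algebra_simps)
  qed
  also have "\<dots> = moment P a (Suc n) + x * moment P a n"
    unfolding moment_def
    by (simp only: suminf_add[OF sP summable_mult[OF sP], symmetric] suminf_mult[OF sP])
  finally show ?thesis .
qed

text \<open>The Pochhammer symbol of length k + 1 can be split at either end: b (b+1)_k = (b+k)
  (b)_k.\<close>

lemma weight_shift_b_same:
  assumes "r \<in> {1..num_len P a}"
  shows "bpar P a r * weight (shift_b a r P) a k = (of_nat k + bpar P a r) * weight P a k"
proof -
  let ?b = "bpar P a r" and ?J = "{1..num_len P a} - {r}"
  have "(\<Prod>j = 1..num_len P a. pochhammer (bpar P a j) k)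
      = pochhammer ?b k * (\<Prod>j\<in>?J. pochhammer (bpar P a j) k)"
    using assms by (intro prod.remove) auto
  moreover have "(\<Prod>j = 1..num_len P a. pochhammer (((bpar P a)(r := ?b + 1)) j) k)
      = pochhammer (?b + 1) k * (\<Prod>j\<in>?J. pochhammer (bpar P a j) k)"
    using assms by (subst prod.remove[of _ r]) auto
  moreover have "?b * pochhammer (?b + 1) k = (of_nat k + ?b) * pochhammer ?b k"
    by (metis pochhammer_rec pochhammer_rec' add.commute)
  ultimately show ?thesis
    by (simp add: weight_def shift_b_def flip: mult.assoc times_divide_eq_right)
qed

lemma weight_shift_b_other: "a' \<noteq> a \<Longrightarrow> weight (shift_b a r P) a' k = weight P a' k"
  by (simp add: weight_def shift_b_def)

text \<open>The same splitting at c - 1, now in the denominators, which both have to be nonzero. As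
  all weights share the parameters c, the factor is the same for every \<open>a\<close>.\<close>

lemma weight_shift_c:
  assumes s: "s \<in> {1..den_len P}"
    and P: "weights_well_defined P" and Q: "weights_well_defined (shift_c s P)"
  shows "(cpar P s - 1) * weight (shift_c s P) a k
    = (of_nat k + (cpar P s - 1)) * weight P a k"
proof -
  let ?c = "cpar P s" and ?J = "{1..den_len P} - {s}"
  let ?D = "\<Prod>j\<in>?J. pochhammer (cpar P j) k"
  have nz: "pochhammer ?c k \<noteq> 0" using P s by (simp add: weights_well_defined_def)
  have nz': "pochhammer (?c - 1) k \<noteq> 0"
    using Q s by (force simp: weights_well_defined_def shift_c_def)
  define X where "X = (\<Prod>j = 1..num_len P a. pochhammer (bpar P a j) k)"
  define e where "e = etapar P a ^ k / fact k"
  have "(\<Prod>j = 1..den_len P. pochhammer (cpar P j) k) = pochhammer ?c k * ?D"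
    using s by (intro prod.remove) auto
  then have w: "weight P a k = X / (pochhammer ?c k * ?D) * e"
    by (simp only: weight_def X_def e_def)
  have "(\<Prod>j = 1..den_len P. pochhammer (((cpar P)(s := ?c - 1)) j) k)
      = pochhammer (?c - 1) k * ?D"
    using s by (subst prod.remove[of _ s]) auto
  moreover have "weight (shift_c s P) a k
      = X / (\<Prod>j = 1..den_len P. pochhammer (((cpar P)(s := ?c - 1)) j) k) * e"
    by (simp add: weight_def shift_c_def X_def e_def)
  ultimately have w': "weight (shift_c s P) a k = X / (pochhammer (?c - 1) k * ?D) * e"
    by simp
  have "(?c - 1) * pochhammer ?c k = (of_nat k + (?c - 1)) * pochhammer (?c - 1) k"
    using pochhammer_rec[of "?c - 1" k] pochhammer_rec'[of "?c - 1" k]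
    by (simp add: add.commute)
  then have *: "(?c - 1) / pochhammer (?c - 1) k = (of_nat k + (?c - 1)) / pochhammer ?c k"
    using nz nz' by (simp add: frac_eq_eq)
  have "(?c - 1) * weight (shift_c s P) a k = (?c - 1) / pochhammer (?c - 1) k * (X / ?D * e)"
    unfolding w' by simp
  also have "\<dots> = (of_nat k + (?c - 1)) * weight P a k"
    unfolding * w by simp
  finally show ?thesis .
qed

section \<open>The banded middle factors\<close>

lemma ipow_Lam: "ipow Lam n = (\<lambda>i j. if j = i + n then 1 else 0)"
proof (induction n)
  case 0
  then show ?case by (auto simp: iid_def intro!: ext)
next
  case (Suc n)
  show ?case
  proof (intro ext)
    fix i j
    have "ipow Lam (Suc n) i j = (\<Sum>k\<in>{i + 1}. Lam i k * ipow Lam n k j)"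
      unfolding ipow.simps by (rule imul_eq_sum) (auto simp: Lam_def)
    then show "ipow Lam (Suc n) i j = (if j = i + Suc n then 1 else 0)"
      unfolding Suc by (simp add: Lam_def)
  qed
qed

text \<open>The projection acts on column i + p, whose residue modulo p is that of row i.\<close>

lemma Lam_a_entry:
  "Lam_a p a i j = (if j = i + p \<and> i mod p = (a - 1) mod p then 1 else 0)"
proof -
  have "Lam_a p a i j = (\<Sum>k\<in>{i + p}. ipow Lam p i k * Iproj p a k j)"
    unfolding Lam_a_def by (rule imul_eq_sum) (auto simp: ipow_Lam)
  then show ?thesis by (auto simp: ipow_Lam Iproj_def)
qed

text \<open>Both middle factors have the shape \<open>j \<mapsto> d j\<close> on the \<open>p\<close>-th superdiagonal plus \<open>x\<close> on the
  diagonal.\<close>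

lemma imul_itr_superdiagonal:
  assumes A: "\<And>i j. A i j = (if j = i + p then d i else 0)" and "p \<noteq> 0"
  shows "row_finite (iadd A (iscale x iid))"
    and "(M \<star> itr (iadd A (iscale x iid))) n j = d j * M n (j + p) + x * M n j"
proof -
  have 0: "iadd A (iscale x iid) i k = 0" if "k \<notin> {i, i + p}" for i k
    using that by (simp add: iadd_def iscale_def iid_def A)
  show "row_finite (iadd A (iscale x iid))"
    unfolding row_finite_def
  proof
    fix i
    have "{k. iadd A (iscale x iid) i k \<noteq> 0} \<subseteq> {i, i + p}" using 0 by blast
    then show "finite {k. iadd A (iscale x iid) i k \<noteq> 0}" by (rule finite_subset) simp
  qed
  have "(M \<star> itr (iadd A (iscale x iid))) n j
      = (\<Sum>k\<in>{j, j + p}. M n k * itr (iadd A (iscale x iid)) k j)"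
    by (rule imul_eq_sum) (simp_all add: itr_def 0)
  then show "(M \<star> itr (iadd A (iscale x iid))) n j = d j * M n (j + p) + x * M n j"
    using \<open>p \<noteq> 0\<close> by (simp add: itr_def iadd_def iscale_def iid_def A)
qed

section \<open>The intertwining relations for the shifts\<close>

text \<open>Moving p columns to the right in the moment matrix keeps the weight and raises the
  moment index by one. Only columns of weight \<open>a\<close> receive this term, matching the fact
  that only this weight changes.\<close>

lemma omega_b_intertwines:
  assumes a: "a \<in> {1..nweights P}" and r: "r \<in> {1..num_len P a}"
    and P: "admissible P" and Q: "admissible (shift_b a r P)"
  shows "itr (Tmat (shift_b a r P)) \<star> omega_b P a r = omega_b P a r \<star> itr (Tmat P)"
proof -
  define p where "p = nweights P"
  define Q where "Q = shift_b a r P"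
  define x where "x = bpar P a r"
  define A where "A = iadd (Lam_a p a) (iscale x iid)"
  define d :: "nat \<Rightarrow> complex" where "d = (\<lambda>j. if j mod p = (a - 1) mod p then 1 else 0)"
  have p: "p \<noteq> 0" "nweights Q = p" using a by (auto simp: p_def Q_def shift_b_def)
  have L: "Lam_a p a i j = (if j = i + p then d i else 0)" for i j
    by (simp add: Lam_a_entry d_def)
  have "(moment_matrix P \<star> itr A) n j = iscale x (moment_matrix Q) n j" for n j
  proof -
    have lhs: "(moment_matrix P \<star> itr A) n j
        = d j * moment_matrix P n (j + p) + x * moment_matrix P n j"
      unfolding A_def by (rule imul_itr_superdiagonal(2)[OF L p(1)])
    show ?thesis
    proof (cases "j mod p = (a - 1) mod p")
      case True
      moreover have "a - 1 < p" using a by (auto simp: p_def)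
      \<comment> \<open>Columns count from 0 and weights from 1, so residue a - 1 selects the
        columns of weight \<open>a\<close>.\<close>
      ultimately have ja: "j mod p + 1 = a" using a by simp
      have "x * moment Q a (n + j div p)
          = moment P a (Suc (n + j div p)) + x * moment P a (n + j div p)"
      proof (rule moment_affine_shift)
        show "moments_converge P" "moments_converge Q"
          using P Q by (simp_all add: admissible_def Q_def)
        show "nweights Q = nweights P" using p(2) by (simp only: p_def)
        show "a \<in> {1..nweights P}" by (rule a)
        show "x * weight Q a k = (of_nat k + x) * weight P a k" for k
          unfolding x_def Q_def by (rule weight_shift_b_same[OF r])
      qed
      then show ?thesis
        unfolding lhs using True ja p
        by (simp add: d_def iscale_def moment_matrix_def flip: p_def)
    next
      case False
      \<comment> \<open>The superdiagonal entry vanishes here and the weight is unchanged, so both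
        sides are \<open>x\<close> times the old moment.\<close>
      then have "j mod p + 1 \<noteq> a" by auto
      then have "moment Q (j mod p + 1) l = moment P (j mod p + 1) l" for l
        by (simp add: moment_def Q_def weight_shift_b_other)
      then show ?thesis
        unfolding lhs using False p
        by (simp add: d_def iscale_def moment_matrix_def flip: p_def)
    qed
  qed
  then have "moment_matrix P \<star> itr A = iscale x (moment_matrix Q)" by (rule ext[OF ext])
  moreover have "row_finite A"
    unfolding A_def by (rule imul_itr_superdiagonal(1)[OF L p(1)])
  ultimately show ?thesis
    using connection_intertwines[of P Q A x] assms
    by (simp add: omega_b_def A_def Q_def x_def p_def admissible_def)
qed

text \<open>Every weight acquires the same affine factor, so the full p-th power of the shift matrix
  serves all columns without a distinction by residue.\<close>

lemma omega_c_intertwines: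
  assumes p: "nweights P \<noteq> 0" and s: "s \<in> {1..den_len P}"
    and P: "admissible P" and Q: "admissible (shift_c s P)"
  shows "itr (Tmat (shift_c s P)) \<star> omega_c P s = omega_c P s \<star> itr (Tmat P)"
proof -
  define p where "p = nweights P"
  define Q where "Q = shift_c s P"
  define x where "x = cpar P s - 1"
  define A where "A = iadd (ipow Lam p) (iscale x iid)"
  have p: "p \<noteq> 0" "nweights Q = p" using p by (auto simp: p_def Q_def shift_c_def)
  have L: "ipow Lam p i j = (if j = i + p then 1 else 0)" for i j
    by (simp add: ipow_Lam)
  have "(moment_matrix P \<star> itr A) n j = iscale x (moment_matrix Q) n j" for n j
  proof -
    let ?a = "j mod p + 1"
    have a: "?a \<in> {1..p}" using p by (simp add: Suc_leI)
    have "x * moment Q ?a (n + j div p)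
        = moment P ?a (Suc (n + j div p)) + x * moment P ?a (n + j div p)"
    proof (rule moment_affine_shift)
      show "moments_converge P" "moments_converge Q"
        using P Q by (simp_all add: admissible_def Q_def)
      show "nweights Q = nweights P" using p(2) by (simp only: p_def)
      show "?a \<in> {1..nweights P}" using a by (simp only: p_def)
      show "x * weight Q ?a k = (of_nat k + x) * weight P ?a k" for k
        unfolding x_def Q_def using s P Q by (intro weight_shift_c) (simp_all add: admissible_def)
    qed
    moreover have "(moment_matrix P \<star> itr A) n j
        = 1 * moment_matrix P n (j + p) + x * moment_matrix P n j"
      unfolding A_def by (rule imul_itr_superdiagonal(2)[OF L p(1)])
    ultimately show ?thesis
      using p by (simp add: iscale_def moment_matrix_def flip: p_def)
  qed
  then have "moment_matrix P \<star> itr A = iscale x (moment_matrix Q)" by (rule ext[OF ext])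
  moreover have "row_finite A"
    unfolding A_def by (rule imul_itr_superdiagonal(1)[OF L p(1)])
  ultimately show ?thesis
    using connection_intertwines[of P Q A x] assms
    by (simp add: omega_c_def A_def Q_def x_def p_def admissible_def)
qed

theorem lemma3p15:
  fixes P :: params and a m r q s :: nat
  assumes "nweights P \<ge> 2"
    and "a \<in> {1..nweights P}" and "m \<in> {1..nweights P}" and "a \<noteq> m"
    and "r \<in> {1..num_len P a}" and "q \<in> {1..num_len P m}" and "s \<in> {1..den_len P}"
    and "admissible P"
    and "admissible (shift_b a r P)"
    and "admissible (shift_b m q P)"
    and "admissible (shift_c s P)"
  shows "itr (Tmat (shift_b a r P)) \<star> omega_b P a r = omega_b P a r \<star> itr (Tmat P)
       \<and> itr (Tmat (shift_b m q P)) \<star> omega_b P m q = omega_b P m q \<star> itr (Tmat P)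
       \<and> itr (Tmat (shift_c s P)) \<star> omega_c P s = omega_c P s \<star> itr (Tmat P)"
  using assms by (auto intro: omega_b_intertwines omega_c_intertwines)

end
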